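(* Let $\mathcal A$ be a gargantuan (unweighted) species of structures that can be represented as $\mathcal A=\mathcal E\circ\mathcal B$ for some species of structures $\mathcal B$, where $\mathcal E$ is the species of sets. Assume that $n$ is a positive integer and $s\in\mathcal A$ is a random $\mathcal A$-structure on $[n]$. In this case, $$\mathbb P(s\text{ is connected})\approx 1-\sum_{k\ge1}\mathfrak d_k\cdot\binom nk\cdot\frac{\mathfrak a_{n-k}}{\mathfrak a_n},$$ where $\mathfrak a_n$ is the counting sequence of $\mathcal A$, $$\mathfrak d_k=\#\{s'\in\mathcal A_k\mid\pi_0(s')\text{ is odd}\}-\#\{s'\in\mathcal A_k\mid\pi_0(s')\text{ is even}\},$$ and $\pi_0(s')$ is the number of connected components of the structure $s'$.
   Context: A species of structures $F$ assigns to each finite set $U$ a finite set $F[U]$ of structures and to each bijection $\sigma:U\to V$ a map $F[\sigma]:F[U]\to F[V]$, functorially ($F[\tau\circ\sigma]=F[\tau]\circ F[\sigma]$, $F[\mathrm{Id}_U]=\mathrm{Id}_{F[U]}$). Write $[n]=\{1,\dots,n\}$, $[0]=\emptyset$. The counting sequence of $\mathcal A$ is $\mathfrak a_n=|\mathcal A[[n]]|$, and $s'\in\mathcal A_k$ means that $s'$ is an $\mathcal A$-structure on $[k]$. Equality of species means natural isomorphism. A random $\mathcal A$-structure on $[n]$ is taken uniformly from $\mathcal A[[n]]$, and $\mathbb P(\cdot)$ denotes the resulting sequence of probabilities indexed by those $n$ with $\mathfrak a_n>0$. $\mathcal E$ is the species of sets ($\mathcal E[U]=\{U\}$). For $\mathcal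 B$ with $\mathcal B[\emptyset]=\emptyset$, an $(\mathcal E\circ\mathcal B)$-structure on $U$ is a partition of $U$ together with a $\mathcal B$-structure on each block; these $\mathcal B$-structures are its connected components, $\pi_0$ is their number, and the structure is connected if it is a single $\mathcal B$-structure ($\pi_0=1$). A sequence $(a_n)$ is gargantuan if (i) $a_{n-1}/a_n\to0$ as $n\to\infty$ and (ii) for each $r\in\mathbb Z_{\ge0}$, $\sum_{k=r}^{n-r}|a_ka_{n-k}|=O(a_{n-r})$. The species $\mathcal A$ is gargantuan if the sequence $a_n=\mathfrak a_n/n!$ is gargantuan; in particular it is assumed that $a_n\neq0$ for almost all $n\in\mathbb Z_{\ge0}$. Notation $\approx$: for a sequence $(x_n)$ and an integer $\ell$, $x_n\approx\sum_{k\ge \ell}f_k(n)$ means that for every integer $r\ge \ell$, $x_n=\sum_{k=\ell}^{r}f_k(n)+O\big(f_{r+1}(n)\big)$, and for every integer $k\ge \ell$, $f_{k+1}(n)=o\big(f_k(n)\big)$, as $n\to\infty$. Here $\ell=0$, $f_0(n)=1$ and $f_k(n)=-\mathfrak d_k\binom nk\frac{\mathfrak a_{n-k}}{\mathfrak a_n}$ for $k\ge1$.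
   Formalization: The relation ≈ is taken over the terms that do not vanish identically (infinitely many remain, as is proved): terms with d_k = 0 are omitted and each error is O(next nonzero term). With zero terms kept the claim fails, e.g. for simple graphs, where d_2 = 0 and d_3 = 2. *)

theory Defs
  imports
    "HOL-Probability.Probability"
    "HOL-Library.Landau_Symbols"
    "HOL-Library.Disjoint_Sets"
    "HOL-Library.Infinite_Set"
begin

section \<open>Species of structures\<close>

text \<open>
  A species with labels in the type \<open>'u\<close>: \<open>structs F U\<close> is the set \<open>F[U]\<close>, and
  \<open>transport F U \<sigma>\<close> is the map \<open>F[\<sigma>]\<close> for the bijection \<open>\<sigma> : U \<rightarrow> \<sigma> ` U\<close>.  HOL functions are
  total, so the domain \<open>U\<close> is an explicit argument of \<open>transport\<close>, and the axiom
  \<open>transport_cong\<close> says that \<open>F[\<sigma>]\<close> depends only on the restriction of \<open>\<sigma>\<close> to \<open>U\<close>.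
\<close>

record ('u, 's) species_data =
  structs :: "'u set \<Rightarrow> 's set"
  transport :: "'u set \<Rightarrow> ('u \<Rightarrow> 'u) \<Rightarrow> 's \<Rightarrow> 's"

locale species =
  fixes F :: "('u, 's) species_data"
  assumes finite_structs: "finite U \<Longrightarrow> finite (structs F U)"
    and transport_in: "\<lbrakk>finite U; inj_on \<sigma> U; s \<in> structs F U\<rbrakk>
      \<Longrightarrow> transport F U \<sigma> s \<in> structs F (\<sigma> ` U)"
    and transport_cong: "\<lbrakk>finite U; inj_on \<sigma> U; \<And>u. u \<in> U \<Longrightarrow> \<sigma> u = \<tau> u; s \<in> structs F U\<rbrakk>
      \<Longrightarrow> transport F U \<sigma> s = transport F U \<tau> s"
    and transport_id: "\<lbrakk>finite U; s \<in> structs F U\<rbrakk> \<Longrightarrow> transport F U id s = s"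
    and transport_comp: "\<lbrakk>finite U; inj_on \<sigma> U; inj_on \<tau> (\<sigma> ` U); s \<in> structs F U\<rbrakk>
      \<Longrightarrow> transport F U (\<tau> \<circ> \<sigma>) s = transport F (\<sigma> ` U) \<tau> (transport F U \<sigma> s)"

text \<open>\<open>\<phi> U\<close> is the component at \<open>U\<close> of a natural isomorphism from \<open>F\<close> to \<open>G\<close>.\<close>

definition natural_iso ::
  "('u, 's) species_data \<Rightarrow> ('u, 't) species_data \<Rightarrow> ('u set \<Rightarrow> 's \<Rightarrow> 't) \<Rightarrow> bool" where
  "natural_iso F G \<phi> \<longleftrightarrow>
     (\<forall>U. finite U \<longrightarrow> bij_betw (\<phi> U) (structs F U) (structs G U)) \<and>
     (\<forall>U \<sigma> s. finite U \<longrightarrow> inj_on \<sigma> U \<longrightarrow> s \<in> structs F U \<longrightarrow>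
        \<phi> (\<sigma> ` U) (transport F U \<sigma> s) = transport G U \<sigma> (\<phi> U s))"

definition set_species :: "('u, 'u set) species_data" where
  "set_species = \<lparr>structs = (\<lambda>U. {U}), transport = (\<lambda>U \<sigma> s. \<sigma> ` s)\<rparr>"

text \<open>
  Composition \<open>F \<circ> G\<close>: a structure on \<open>U\<close> is a triple \<open>(P, f, g)\<close> of a partition \<open>P\<close> of \<open>U\<close>, an
  \<open>F\<close>-structure \<open>f\<close> on the set \<open>P\<close> of blocks, and a family \<open>g\<close> (extensional, i.e. \<open>undefined\<close>
  outside \<open>P\<close>) of \<open>G\<close>-structures on the blocks.  For a block \<open>q\<close> of the transported partition,
  \<open>{u \<in> U. \<sigma> u \<in> q}\<close> is the block of \<open>P\<close> it comes from.
\<close>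

definition compose_species ::
  "('u set, 's) species_data \<Rightarrow> ('u, 't) species_data
    \<Rightarrow> ('u, 'u set set \<times> 's \<times> ('u set \<Rightarrow> 't)) species_data" where
  "compose_species F G =
     \<lparr>structs = (\<lambda>U. {(P, f, g). partition_on U P \<and> f \<in> structs F P \<and>
                                 g \<in> (\<Pi>\<^sub>E p\<in>P. structs G p)}),
      transport = (\<lambda>U \<sigma> (P, f, g).
        ((`) \<sigma> ` P,
         transport F P ((`) \<sigma>) f,
         \<lambda>q\<in>(`) \<sigma> ` P. transport G {u \<in> U. \<sigma> u \<in> q} \<sigma> (g {u \<in> U. \<sigma> u \<in> q})))\<rparr>"

lemma species_set_species: "species (set_species :: ('u, 'u set) species_data)"
  by unfold_locales (auto simp: set_species_def image_iff)

lemma partition_on_image_inj: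
  assumes "partition_on U P" "inj_on \<sigma> U"
  shows "partition_on (\<sigma> ` U) ((`) \<sigma> ` P)" "inj_on ((`) \<sigma>) P"
    "\<And>p. p \<in> P \<Longrightarrow> {u \<in> U. \<sigma> u \<in> \<sigma> ` p} = p"
proof -
  have sub: "p \<subseteq> U" if "p \<in> P" for p
    using assms(1) that by (auto simp: partition_on_def)
  show pre: "{u \<in> U. \<sigma> u \<in> \<sigma> ` p} = p" if "p \<in> P" for p
    using sub[OF that] assms(2) by (auto dest: inj_onD)
  show "inj_on ((`) \<sigma>) P"
    by (rule inj_onI) (metis pre)
  show "partition_on (\<sigma> ` U) ((`) \<sigma> ` P)"
    unfolding partition_on_def disjoint_def
  proof (intro conjI ballI impI)
    show "\<Union> ((`) \<sigma> ` P) = \<sigma> ` U"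
      using assms(1) by (auto simp: partition_on_def)
    show "{} \<notin> (`) \<sigma> ` P"
      using assms(1) by (auto simp: partition_on_def)
    fix a b assume ab: "a \<in> (`) \<sigma> ` P" "b \<in> (`) \<sigma> ` P" "a \<noteq> b"
    then obtain p q where pq: "p \<in> P" "q \<in> P" "a = \<sigma> ` p" "b = \<sigma> ` q" "p \<noteq> q" by blast
    then have "p \<inter> q = {}"
      using assms(1) by (auto simp: partition_on_def disjoint_def)
    then show "a \<inter> b = {}"
      using pq sub assms(2) by (metis image_empty inj_on_image_Int)
  qed
qed

lemma species_compose_species:
  assumes "species F" "species G"
  shows "species (compose_species F G)"
proof
  interpret F: species F by fact
  interpret G: species G by fact
  have finP: "finite P" "\<And>p. p \<in> P \<Longrightarrow> finite p \<and> p \<subseteq> U"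
    if "partition_on U P" "finite U" for U :: "'a set" and P
  proof -
    show "finite P" using that finite_elements by blast
    show "finite p \<and> p \<subseteq> U" if "p \<in> P" for p
      using that \<open>partition_on U P\<close> \<open>finite U\<close>
      by (metis Union_upper finite_subset partition_onD1)
  qed
  fix U :: "'a set"
  assume U: "finite U"
  have "structs (compose_species F G) U \<subseteq>
     (\<Union>P\<in>{P. partition_on U P}. {P} \<times> structs F P \<times> (\<Pi>\<^sub>E p\<in>P. structs G p))"
    by (auto simp: compose_species_def)
  moreover have "finite \<dots>"
    using U finP finitely_many_partition_on[OF U]
    by (intro finite_UN_I finite_cartesian_product finite_PiE)
       (auto intro: F.finite_structs G.finite_structs)
  ultimately show "finite (structs (compose_species F G) U)"
    by (rule finite_subset)
  fix s assume "s \<in> structs (compose_species F G) U"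
  then obtain P f g where s: "s = (P, f, g)" and P: "partition_on U P"
    and f: "f \<in> structs F P" and g: "g \<in> (\<Pi>\<^sub>E p\<in>P. structs G p)"
    by (auto simp: compose_species_def)
  note fP = finP[OF P U]
  have inj_p: "inj_on \<sigma> p" if "inj_on \<sigma> U" "p \<in> P" for \<sigma> :: "'a \<Rightarrow> 'a" and p
    using that fP by (meson inj_on_subset)
  have img_id: "(`) id = (id :: 'a set \<Rightarrow> 'a set)" by auto
  have "(\<lambda>p\<in>P. transport G {u \<in> U. u \<in> p} id (g {u \<in> U. u \<in> p})) = g"
  proof
    fix p
    show "(\<lambda>p\<in>P. transport G {u \<in> U. u \<in> p} id (g {u \<in> U. u \<in> p})) p = g p"
    proof (cases "p \<in> P")
      case True
      have "{u \<in> U. u \<in> p} = p" using fP(2)[OF True] by auto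
      moreover have "transport G p id (g p) = g p"
        using fP(2)[OF True] PiE_mem[OF g True] by (intro G.transport_id) auto
      ultimately show ?thesis using True by simp
    next
      case False
      then show ?thesis using PiE_arb[OF g] by simp
    qed
  qed
  then show "transport (compose_species F G) U id s = s"
    using fP f by (simp add: s compose_species_def F.transport_id img_id)
  fix \<sigma> :: "'a \<Rightarrow> 'a"
  assume \<sigma>: "inj_on \<sigma> U"
  note p\<sigma> = partition_on_image_inj[OF P \<sigma>]
  have gt: "transport G p \<sigma> (g p) \<in> structs G (\<sigma> ` p)" if "p \<in> P" for p
    using that fP inj_p[OF \<sigma> that] PiE_mem[OF g that] by (auto intro: G.transport_in)
  show "transport (compose_species F G) U \<sigma> s \<in> structs (compose_species F G) (\<sigma> ` U)"
    using p\<sigma> fP f gt by (auto simp: s compose_species_def intro!: F.transport_in)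
  {
    fix \<tau> :: "'a \<Rightarrow> 'a"
    assume eq: "\<And>u. u \<in> U \<Longrightarrow> \<sigma> u = \<tau> u"
    have \<tau>: "inj_on \<tau> U" using \<sigma> eq by (metis inj_on_cong)
    note p\<tau> = partition_on_image_inj[OF P \<tau>]
    have im: "\<sigma> ` p = \<tau> ` p" if "p \<in> P" for p
      using fP(2)[OF that] eq by (intro image_cong) auto
    have tr: "transport G p \<sigma> (g p) = transport G p \<tau> (g p)" if "p \<in> P" for p
      using that fP(2)[OF that] inj_p[OF \<sigma> that] PiE_mem[OF g that] eq
      by (intro G.transport_cong) auto
    have im2: "(`) \<sigma> ` P = (`) \<tau> ` P" by (rule image_cong[OF refl im])
    have G: "transport G {u \<in> U. \<sigma> u \<in> q} \<sigma> (g {u \<in> U. \<sigma> u \<in> q}) =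
          transport G {u \<in> U. \<tau> u \<in> q} \<tau> (g {u \<in> U. \<tau> u \<in> q})" if "q \<in> (`) \<tau> ` P" for q
    proof -
      obtain p where p: "p \<in> P" "q = \<tau> ` p" using \<open>q \<in> (`) \<tau> ` P\<close> by blast
      have "{u \<in> U. \<sigma> u \<in> q} = p" using p p\<sigma>(3)[OF p(1)] im[OF p(1)] by simp
      moreover have "{u \<in> U. \<tau> u \<in> q} = p" using p p\<tau>(3)[OF p(1)] by simp
      ultimately show ?thesis using tr[OF p(1)] by simp
    qed
    have F: "transport F P ((`) \<sigma>) f = transport F P ((`) \<tau>) f"
      by (rule F.transport_cong[OF fP(1) p\<sigma>(2) im f])
    show "transport (compose_species F G) U \<sigma> s = transport (compose_species F G) U \<tau> s"
      unfolding s compose_species_def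
      by (simp only: species_data.simps prod.case im2 F restrict_ext[OF G])
  }
  {
    fix \<tau> :: "'a \<Rightarrow> 'a"
    assume \<tau>: "inj_on \<tau> (\<sigma> ` U)"
    have \<tau>\<sigma>: "inj_on (\<tau> \<circ> \<sigma>) U" using \<sigma> \<tau> by (rule comp_inj_on)
    note p\<tau> = partition_on_image_inj[OF p\<sigma>(1) \<tau>]
    note p\<tau>\<sigma> = partition_on_image_inj[OF P \<tau>\<sigma>]
    have im: "(`) (\<tau> \<circ> \<sigma>) = (`) \<tau> \<circ> (`) \<sigma>" by (auto simp: image_comp)
    have im2: "(`) (\<tau> \<circ> \<sigma>) ` P = (`) \<tau> ` (`) \<sigma> ` P" by (simp add: im image_comp)
    have F: "transport F P ((`) (\<tau> \<circ> \<sigma>)) f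
        = transport F ((`) \<sigma> ` P) ((`) \<tau>) (transport F P ((`) \<sigma>) f)"
      unfolding im using fP p\<sigma> p\<tau> f by (intro F.transport_comp) auto
    let ?h = "\<lambda>q\<in>(`) \<sigma> ` P. transport G {u \<in> U. \<sigma> u \<in> q} \<sigma> (g {u \<in> U. \<sigma> u \<in> q})"
    have "transport G {u \<in> U. (\<tau> \<circ> \<sigma>) u \<in> q} (\<tau> \<circ> \<sigma>) (g {u \<in> U. (\<tau> \<circ> \<sigma>) u \<in> q}) =
          transport G {u \<in> \<sigma> ` U. \<tau> u \<in> q} \<tau> (?h {u \<in> \<sigma> ` U. \<tau> u \<in> q})"
      if "q \<in> (`) \<tau> ` (`) \<sigma> ` P" for q
    proof -
      obtain p where p: "p \<in> P" "q = \<tau> ` \<sigma> ` p" using \<open>q \<in> (`) \<tau> ` (`) \<sigma> ` P\<close> by blast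
      have 1: "{u \<in> U. (\<tau> \<circ> \<sigma>) u \<in> q} = p"
        using p\<tau>\<sigma>(3)[OF p(1)] by (simp add: p(2) image_comp)
      have 2: "{u \<in> \<sigma> ` U. \<tau> u \<in> q} = \<sigma> ` p"
        using p\<tau>(3)[of "\<sigma> ` p"] p by simp
      have 3: "?h (\<sigma> ` p) = transport G p \<sigma> (g p)"
        using p\<sigma>(3)[OF p(1)] p(1) by simp
      have "inj_on \<tau> (\<sigma> ` p)"
        using \<tau> fP(2)[OF p(1)] by (meson image_mono inj_on_subset)
      then have "transport G p (\<tau> \<circ> \<sigma>) (g p) = transport G (\<sigma> ` p) \<tau> (transport G p \<sigma> (g p))"
        using fP(2)[OF p(1)] inj_p[OF \<sigma> p(1)] PiE_mem[OF g p(1)]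
        by (intro G.transport_comp) auto
      then show ?thesis unfolding 1 2 3 .
    qed
    then have G: "(\<lambda>q\<in>(`) \<tau> ` (`) \<sigma> ` P.
           transport G {u \<in> U. (\<tau> \<circ> \<sigma>) u \<in> q} (\<tau> \<circ> \<sigma>) (g {u \<in> U. (\<tau> \<circ> \<sigma>) u \<in> q})) =
        (\<lambda>q\<in>(`) \<tau> ` (`) \<sigma> ` P.
           transport G {u \<in> \<sigma> ` U. \<tau> u \<in> q} \<tau> (?h {u \<in> \<sigma> ` U. \<tau> u \<in> q}))"
      by (intro restrict_ext) blast
    show "transport (compose_species F G) U (\<tau> \<circ> \<sigma>) s =
      transport (compose_species F G) (\<sigma> ` U) \<tau> (transport (compose_species F G) U \<sigma> s)"
      unfolding s compose_species_def
      by (simp only: species_data.simps prod.case im2 F G)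
  }
qed

text \<open>The connected components are the \<open>G\<close>-structures on the blocks, tagged with their block.\<close>

definition components :: "'u set set \<times> 's \<times> ('u set \<Rightarrow> 't) \<Rightarrow> ('u set \<times> 't) set" where
  "components = (\<lambda>(P, f, g). (\<lambda>p. (p, g p)) ` P)"

definition num_components :: "'u set set \<times> 's \<times> ('u set \<Rightarrow> 't) \<Rightarrow> nat" where
  "num_components s = card (components s)"

definition is_connected :: "'u set set \<times> 's \<times> ('u set \<Rightarrow> 't) \<Rightarrow> bool" where
  "is_connected s \<longleftrightarrow> num_components s = 1"

definition counting_seq :: "(nat, 's) species_data \<Rightarrow> nat \<Rightarrow> nat" where
  "counting_seq A n = card (structs A {1..n})"

text \<open>
  The components of an \<open>A\<close>-structure are read off along the isomorphism \<open>\<phi>\<close> from \<open>A\<close> to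
  the composite species.
\<close>

definition signed_count ::
  "(nat, 's) species_data \<Rightarrow> (nat set \<Rightarrow> 's \<Rightarrow> nat set set \<times> 'e \<times> (nat set \<Rightarrow> 't)) \<Rightarrow> nat \<Rightarrow> int"
  where
  "signed_count A \<phi> k =
     int (card {s \<in> structs A {1..k}. odd (num_components (\<phi> {1..k} s))}) -
     int (card {s \<in> structs A {1..k}. even (num_components (\<phi> {1..k} s))})"


section \<open>Gargantuan sequences and asymptotic expansions\<close>

definition gargantuan :: "(nat \<Rightarrow> real) \<Rightarrow> bool" where
  "gargantuan a \<longleftrightarrow>
     (\<forall>\<^sub>F n in sequentially. a n \<noteq> 0) \<and>
     (\<lambda>n. a (n - 1) / a n) \<longlonglongrightarrow> 0 \<and>
     (\<forall>r. (\<lambda>n. \<Sum>k=r..n - r. \<bar>a k * a (n - k)\<bar>) \<in> O(\<lambda>n. a (n - r)))"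

definition gargantuan_species :: "(nat, 's) species_data \<Rightarrow> bool" where
  "gargantuan_species A \<longleftrightarrow> gargantuan (\<lambda>n. real (counting_seq A n) / fact n)"

definition expansion_from :: "nat \<Rightarrow> (nat \<Rightarrow> real) \<Rightarrow> (nat \<Rightarrow> nat \<Rightarrow> real) \<Rightarrow> bool" where
  "expansion_from l x f \<longleftrightarrow>
     (\<forall>r\<ge>l. (\<lambda>n. x n - (\<Sum>k=l..r. f k n)) \<in> O(f (Suc r))) \<and>
     (\<forall>k\<ge>l. f (Suc k) \<in> o(f k))"

text \<open>
  \<open>expansion_from\<close> cannot hold as soon as some term vanishes identically while a later one does
  not, because \<open>o(0)\<close> contains only eventually vanishing functions.  This does happen for the series
  considered here: for simple graphs the coefficient of index 2 is 0 (one connected and one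
  disconnected graph on two vertices), and that of index 3 is 2.  As usual for asymptotic series,
  identically vanishing terms are therefore left out: the definition below says that infinitely many
  terms are left, and that \<open>expansion_from\<close> holds for the series of those terms.
\<close>

definition nonzero_terms :: "nat \<Rightarrow> (nat \<Rightarrow> nat \<Rightarrow> real) \<Rightarrow> nat set" where
  "nonzero_terms l f = {k. l \<le> k \<and> f k \<noteq> (\<lambda>_. 0)}"

definition asymp_expansion :: "nat \<Rightarrow> (nat \<Rightarrow> real) \<Rightarrow> (nat \<Rightarrow> nat \<Rightarrow> real) \<Rightarrow> bool" where
  "asymp_expansion l x f \<longleftrightarrow>
     infinite (nonzero_terms l f) \<and>
     expansion_from 0 x (\<lambda>i. f (enumerate (nonzero_terms l f) i))"

lemma enumerate_atLeast: "enumerate {l::nat..} i = l + i"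
proof (induction i)
  case 0
  show ?case by (simp add: enumerate_0) (rule Least_equality, auto)
next
  case (Suc i)
  have "(LEAST s. s \<in> {l..} \<and> l + i < s) = Suc (l + i)"
    by (rule Least_equality) auto
  then show ?case
    using Suc by (simp add: enumerate_Suc'' infinite_Ici)
qed

lemma asymp_expansion_iff_expansion_from:
  assumes "\<And>k. l \<le> k \<Longrightarrow> f k \<noteq> (\<lambda>_. 0)"
  shows "asymp_expansion l x f \<longleftrightarrow> expansion_from l x f"
proof -
  have S: "nonzero_terms l f = {l..}"
    using assms by (auto simp: nonzero_terms_def)
  have sum: "(\<Sum>i=0..r. f (l + i) n) = (\<Sum>k=l..l + r. f k n)" for r n
    using sum.shift_bounds_cl_nat_ivl[of "\<lambda>k. f k n" 0 l r] by (simp add: add.commute)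
  have all: "(\<forall>r\<ge>l. Q r) \<longleftrightarrow> (\<forall>r. Q (l + r))" for Q
    by (metis le_add1 le_Suc_ex)
  show ?thesis
    unfolding asymp_expansion_def S enumerate_atLeast expansion_from_def sum all
    by (simp add: infinite_Ici)
qed

end

theory Submission
  imports Defs
begin

text \<open>
  Let \<open>H\<close> be the exponential generating function of \<open>B\<close>, \<open>F = exp H\<close> that of \<open>A\<close> and
  \<open>C = exp (- H) = 1 / F\<close>.  Counting each structure with the sign of its number of components
  replaces \<open>H\<close> by \<open>- H\<close>, so \<open>d\<^sub>k = - k! [z\<^sup>k] C\<close>, and the claim is Bender's
  expansion \<open>[z\<^sup>n] H = (\<Sum>k<R. C\<^sub>k F\<^sub>n\<^sub>-\<^sub>k) + O(F\<^sub>n\<^sub>-\<^sub>R)\<close>.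

  For that, let \<open>\<theta> = z d/dz\<close>.  As \<open>0 \<le> H\<^sub>n \<le> F\<^sub>n\<close>, the gargantuan property bounds the middle of
  the convolution \<open>\<theta>F = F \<theta>H\<close>, so modulo \<open>O(n F\<^sub>n\<^sub>-\<^sub>R)\<close> it equals \<open>F\<^sub>< \<theta>H + (\<theta>H)\<^sub>< F\<close>, where \<open><\<close> denotes
  truncation below degree \<open>R\<close>.  Multiplying by \<open>C\<^sub><\<close>, and using \<open>C F = 1\<close> and \<open>\<theta>C = - C \<theta>H\<close> below
  degree \<open>R\<close>, gives \<open>C\<^sub>< \<theta>F = \<theta>H - (\<theta>C\<^sub><) F\<close>, that is, \<open>\<theta>H = \<theta>(C\<^sub>< F)\<close>
  modulo the same error.

  Infinitely many \<open>d\<^sub>k\<close> are nonzero because a polynomial \<open>C\<close> would give a linear recurrence for \<open>F\<^sub>n\<close>,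
  which is incompatible with \<open>F\<^sub>n\<^sub>-\<^sub>1 = o(F\<^sub>n)\<close>.
\<close>

unbundle no vec_syntax
unbundle fps_syntax

section \<open>Enumeration of sets of species structures\<close>

lemma (in species) inj_on_transport:
  assumes "finite U" "inj_on \<sigma> U"
  shows "inj_on (transport F U \<sigma>) (structs F U)"
proof (rule inj_on_inverseI)
  fix s assume s: "s \<in> structs F U"
  let ?\<tau> = "inv_into U \<sigma>"
  have "transport F (\<sigma> ` U) ?\<tau> (transport F U \<sigma> s) = transport F U (?\<tau> \<circ> \<sigma>) s"
    using assms s inj_on_inv_into[of "\<sigma> ` U" \<sigma> U] by (simp add: transport_comp)
  \<comment> \<open>The composite agrees with \<open>id\<close> only on \<open>U\<close>, which is
    all that \<open>transport_cong\<close> asks for.\<close>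
  also have "\<dots> = transport F U id s"
    using assms s inj_on_inv_into[of "\<sigma> ` U" \<sigma> U]
    by (intro transport_cong comp_inj_on) auto
  finally show "transport F (\<sigma> ` U) ?\<tau> (transport F U \<sigma> s) = s"
    using assms s by (simp add: transport_id)
qed

lemma (in species) card_structs_cong:
  assumes "finite U" "finite V" "card U = card V"
  shows "card (structs F U) = card (structs F V)"
proof -
  have le: "card (structs F X) \<le> card (structs F Y)"
    if XY: "finite X" "finite Y" "card X = card Y" for X Y
  proof -
    obtain \<sigma> where \<sigma>: "bij_betw \<sigma> X Y"
      using XY finite_same_card_bij by blast
    then have "inj_on \<sigma> X" "\<sigma> ` X = Y" by (auto simp: bij_betw_def)
    with XY show ?thesis
      using transport_in[of X \<sigma>]
      by (intro card_inj_on_le[OF inj_on_transport[of X \<sigma>]] finite_structs) auto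
  qed
  from assms le[of U V] le[of V U] show ?thesis by simp
qed

section \<open>Set partitions and the exponential formula\<close>

text \<open>The block of \<open>x\<close> is \<open>insert x S\<close> for a unique subset
  \<open>S\<close> of \<open>U\<close>, and the other blocks form an arbitrary partition of
  \<open>U - S\<close>.\<close>

lemma sum_partition_on_insert:
  fixes h :: "'a set \<Rightarrow> 'b::comm_semiring_1"
  assumes U: "finite U" and x: "x \<notin> U"
  shows "(\<Sum>P | partition_on (insert x U) P. \<Prod>p\<in>P. h p) =
    (\<Sum>S\<in>Pow U. h (insert x S) * (\<Sum>Q | partition_on (U - S) Q. \<Prod>p\<in>Q. h p))"
proof -
  let ?T = "SIGMA S:Pow U. {Q. partition_on (U - S) Q}"
  let ?f = "\<lambda>(S, Q). insert (insert x S) Q"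
  have notin: "x \<notin> q" if "partition_on (U - S) Q" "q \<in> Q" for S Q q
    using that x by (auto simp: partition_on_def)
  have bij: "bij_betw ?f ?T {P. partition_on (insert x U) P}"
    unfolding bij_betw_def
  proof
    show "inj_on ?f ?T"
    proof (rule inj_onI, clarify)
      fix S Q S' Q'
      assume S: "S \<subseteq> U" "partition_on (U - S) Q" and S': "S' \<subseteq> U" "partition_on (U - S') Q'"
        and eq: "insert (insert x S) Q = insert (insert x S') Q'"
      have xS: "insert x S \<notin> Q" "insert x S' \<notin> Q'"
        using notin[OF S(2)] notin[OF S'(2)] by blast+
      have "insert x S \<in> insert (insert x S') Q'" unfolding eq[symmetric] by simp
      then have "insert x S = insert x S'"
        using notin[OF S'(2), of "insert x S"] by auto
      then have "S = S'" using S(1) S'(1) x by (metis insert_ident subsetD)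
      moreover have "Q = Q'"
        using eq xS unfolding \<open>S = S'\<close> by (metis Diff_insert_absorb)
      ultimately show "S = S' \<and> Q = Q'" by simp
    qed
    show "?f ` ?T = {P. partition_on (insert x U) P}"
    proof (intro equalityI subsetI)
      fix P assume "P \<in> ?f ` ?T"
      then obtain S Q where P: "P = insert (insert x S) Q" and S: "S \<subseteq> U" "partition_on (U - S) Q"
        by auto
      have "disjnt (insert x S) (\<Union>Q)"
        using S(2) x by (auto simp: partition_on_def disjnt_def)
      moreover have "insert x U - insert x S = U - S" using x by blast
      ultimately show "P \<in> {P. partition_on (insert x U) P}"
        using S by (simp add: P partition_on_insert subset_insertI2)
    next
      fix P assume "P \<in> {P. partition_on (insert x U) P}"
      then have P: "partition_on (insert x U) P" by simp
      then obtain p where p: "p \<in> P" "x \<in> p" using partition_onD1 by fastforce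
      have sub: "p \<subseteq> insert x U" using p P by (auto simp: partition_on_def)
      have dis: "disjnt p (\<Union>(P - {p}))"
        using p P by (auto simp: partition_on_def disjoint_def disjnt_def)
      have "insert p (P - {p}) = P" using p by blast
      then have "partition_on (insert x U - p) (P - {p})"
        using P partition_on_insert[OF dis, of "insert x U"] by simp
      moreover have "insert x U - p = U - (p - {x})" using p x by blast
      ultimately have "(p - {x}, P - {p}) \<in> ?T" using sub by auto
      moreover have "?f (p - {x}, P - {p}) = P" using p by (auto simp: insert_absorb)
      ultimately show "P \<in> ?f ` ?T" by (metis image_eqI)
    qed
  qed
  have prod: "(\<Prod>p\<in>insert (insert x S) Q. h p) = h (insert x S) * (\<Prod>p\<in>Q. h p)"
    if "partition_on (U - S) Q" for S Q
  proof -
    have "finite Q" using that U finite_elements by blast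
    moreover have "insert x S \<notin> Q" using notin[OF that] by blast
    ultimately show ?thesis by simp
  qed
  have "(\<Sum>P | partition_on (insert x U) P. \<Prod>p\<in>P. h p) =
    (\<Sum>y\<in>?T. \<Prod>p\<in>?f y. h p)"
    by (rule sum.reindex_bij_betw[OF bij, symmetric])
  also have "\<dots> = (\<Sum>(S, Q)\<in>?T. h (insert x S) * (\<Prod>p\<in>Q. h p))"
    by (intro sum.cong) (auto simp: prod)
  also have "\<dots> = (\<Sum>S\<in>Pow U. h (insert x S) * (\<Sum>Q | partition_on (U - S) Q. \<Prod>p\<in>Q. h p))"
    using U by (subst sum.Sigma[symmetric]) (auto simp: finitely_many_partition_on sum_distrib_left)
  finally show ?thesis .
qed

lemma sum_Pow_card:
  fixes g :: "nat \<Rightarrow> 'b::comm_semiring_1"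
  assumes "finite U"
  shows "(\<Sum>S\<in>Pow U. g (card S)) = (\<Sum>k\<le>card U. of_nat (card U choose k) * g k)"
proof -
  have "(\<Sum>S\<in>Pow U. g (card S)) =
      (\<Sum>k\<le>card U. \<Sum>S | S \<in> Pow U \<and> card S = k. g (card S))"
    using assms by (intro sum.group[symmetric]) (auto intro: card_mono)
  also have "\<dots> = (\<Sum>k\<le>card U. of_nat (card U choose k) * g k)"
    using n_subsets[OF assms] by (intro sum.cong) auto
  finally show ?thesis .
qed

text \<open>The exponential formula; both sides satisfy the recursion obtained from \<open>G' = c H' G\<close>,
  on the left by removing the block of a fixed element.\<close>

lemma sum_partition_on_exp:
  fixes h :: "nat \<Rightarrow> real"
  assumes "finite U" "h 0 = 0"
  shows "(\<Sum>P | partition_on U P. \<Prod>p\<in>P. c * h (card p)) =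
    fact (card U) * (fps_exp c oo Abs_fps (\<lambda>n. h n / fact n)) $ card U"
  using assms(1)
proof (induction U rule: finite_psubset_induct)
  case (psubset U)
  define H where "H = Abs_fps (\<lambda>n. h n / fact n)"
  define G where "G = fps_exp c oo H"
  have H0: "H $ 0 = 0" by (simp add: H_def assms(2))
  show ?case
  proof (cases "U = {}")
    case True
    then show ?thesis by (simp add: partition_on_empty)
  next
    case False
    then obtain x V where V: "U = insert x V" "x \<notin> V" by (meson mk_disjoint_insert ex_in_conv)
    then have fV: "finite V" using psubset by simp
    define n where "n = card V"
    have n: "card U = Suc n" using V fV by (simp add: n_def)
    have IH: "(\<Sum>Q | partition_on (V - S) Q. \<Prod>p\<in>Q. c * h (card p)) =
        fact (n - card S) * G $ (n - card S)" if "S \<subseteq> V" for S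
    proof -
      have "V - S \<subset> U" using V by blast
      moreover have "card (V - S) = n - card S"
        using that finite_subset[OF that fV] by (simp add: n_def card_Diff_subset)
      ultimately show ?thesis using psubset.IH[of "V - S"] by (simp add: G_def H_def)
    qed
    have "fps_deriv G = (fps_const c * G) * fps_deriv H"
      unfolding G_def fps_compose_deriv[OF H0] fps_exp_deriv fps_compose_mult_distrib[OF H0]
        fps_const_compose ..
    then have "fps_deriv G = fps_const c * (fps_deriv H * G)" by (simp add: mult_ac)
    then have "fps_deriv G $ n = c * (fps_deriv H * G) $ n" by simp
    then have "real (Suc n) * G $ Suc n =
        c * (\<Sum>k\<le>n. fps_deriv H $ k * G $ (n - k))"
      by (simp add: fps_mult_nth atLeast0AtMost)
    also have "\<dots> = (\<Sum>k\<le>n. c * (h (Suc k) / fact k) * G $ (n - k))"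
      unfolding sum_distrib_left by (intro sum.cong) (auto simp: H_def simp del: of_nat_Suc)
    finally have rec: "real (Suc n) * G $ Suc n = \<dots>" .
    have "(\<Sum>P | partition_on U P. \<Prod>p\<in>P. c * h (card p)) =
      (\<Sum>S\<in>Pow V. c * h (card (insert x S)) * (fact (n - card S) * G $ (n - card S)))"
      unfolding V(1) sum_partition_on_insert[OF fV V(2)] by (intro sum.cong) (auto simp: IH)
    also have "\<dots> = (\<Sum>S\<in>Pow V. c * h (Suc (card S)) * (fact (n - card S) * G $ (n - card S)))"
    proof (intro sum.cong refl)
      fix S assume "S \<in> Pow V"
      then have "finite S" "x \<notin> S" using fV V finite_subset by auto
      then show "c * h (card (insert x S)) * (fact (n - card S) * G $ (n - card S)) =
        c * h (Suc (card S)) * (fact (n - card S) * G $ (n - card S))" by simp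
    qed
    also have "\<dots> = (\<Sum>k\<le>n. real (n choose k) * (c * h (Suc k) * (fact (n - k) * G $ (n - k))))"
      using sum_Pow_card[OF fV, of "\<lambda>k. c * h (Suc k) * (fact (n - k) * G $ (n - k))"]
      by (simp add: n_def)
    \<comment> \<open>\<open>(n choose k) * fact (n - k) = fact n / fact k\<close>, and
      \<open>h (Suc k) / fact k\<close> is coefficient \<open>k\<close> of
      \<open>fps_deriv H\<close>.\<close>
    also have "\<dots> = fact n * (\<Sum>k\<le>n. c * (h (Suc k) / fact k) * G $ (n - k))"
      unfolding sum_distrib_left
      by (intro sum.cong) (auto simp: binomial_fact field_simps)
    also have "\<dots> = fact (Suc n) * G $ Suc n"
      unfolding rec[symmetric] by (simp add: field_simps)
    finally show ?thesis by (simp add: n G_def H_def)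
  qed
qed

section \<open>Counting structures by their number of components\<close>

text \<open>The set species offers one structure on the set of blocks, so only the partition and
  independent choices on its blocks remain.\<close>

lemma card_compose_set_species:
  fixes B :: "('u, 't) species_data"
  assumes B: "species B" and U: "finite U"
  shows "card {s \<in> structs (compose_species set_species B) U. R (num_components s)} =
    (\<Sum>P | partition_on U P \<and> R (card P). \<Prod>p\<in>P. card (structs B p))"
proof -
  interpret species B by fact
  have fin: "finite P" "\<And>p. p \<in> P \<Longrightarrow> finite p" if "partition_on U P" for P
    using that U finite_elements by (blast, metis Union_upper finite_subset partition_onD1)
  let ?T = "SIGMA P:{P. partition_on U P \<and> R (card P)}. \<Pi>\<^sub>E p\<in>P. structs B p"
  \<comment> \<open>The block tags make the components distinct, so they correspond to the
    blocks.\<close>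
  have num: "num_components (P, f, g) = card P" for P f and g :: "'u set \<Rightarrow> 't"
    by (auto simp: num_components_def components_def intro!: card_image inj_onI)
  have "{s \<in> structs (compose_species set_species B) U. R (num_components s)} =
      (\<lambda>(P, g). (P, P, g)) ` ?T"
    by (auto simp: compose_species_def set_species_def num image_iff)
  also have "card \<dots> = card ?T" by (intro card_image) (auto intro!: inj_onI)
  also have "\<dots> = (\<Sum>P | partition_on U P \<and> R (card P). card (\<Pi>\<^sub>E p\<in>P. structs B p))"
    using U fin finitely_many_partition_on[OF U] finite_structs
    by (intro card_SigmaI) (auto intro!: finite_PiE elim: rev_finite_subset)
  also have "\<dots> = (\<Sum>P | partition_on U P \<and> R (card P). \<Prod>p\<in>P. card (structs B p))"
    using fin by (intro sum.cong) (auto simp: card_PiE)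
  finally show ?thesis .
qed

text \<open>Relabelling makes the weight of a block depend on its size alone. The predicate
  \<open>R\<close> stays general to cover all structures, both parities, and a single
  component.\<close>

lemma card_structs_num_components:
  fixes A :: "(nat, 'a) species_data" and B :: "(nat, 'b) species_data"
  assumes B: "species B" and iso: "natural_iso A (compose_species set_species B) \<phi>"
    and U: "finite U"
  shows "card {s \<in> structs A U. R (num_components (\<phi> U s))} =
    (\<Sum>P | partition_on U P \<and> R (card P). \<Prod>p\<in>P. counting_seq B (card p))"
proof -
  interpret species B by fact
  let ?E = "compose_species set_species B"
  have bij: "bij_betw (\<phi> U) (structs A U) (structs ?E U)"
    using iso U by (simp add: natural_iso_def)
  have "bij_betw (\<phi> U) {s \<in> structs A U. R (num_components (\<phi> U s))}
      {s \<in> structs ?E U. R (num_components s)}"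
    using bij unfolding bij_betw_def by (fastforce intro: inj_on_subset)
  then have "card {s \<in> structs A U. R (num_components (\<phi> U s))} =
      card {s \<in> structs ?E U. R (num_components s)}"
    by (rule bij_betw_same_card)
  also have "\<dots> = (\<Sum>P | partition_on U P \<and> R (card P). \<Prod>p\<in>P. card (structs B p))"
    by (rule card_compose_set_species[OF B U])
  also have "\<dots> = (\<Sum>P | partition_on U P \<and> R (card P). \<Prod>p\<in>P. counting_seq B (card p))"
  proof (intro sum.cong prod.cong refl)
    fix P p assume "P \<in> {P. partition_on U P \<and> R (card P)}" "p \<in> P"
    then have "finite p" using U by (metis CollectD Union_upper finite_subset partition_onD1)
    then show "card (structs B p) = counting_seq B (card p)"
      unfolding counting_seq_def by (intro card_structs_cong) auto
  qed
  finally show ?thesis .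
qed

lemma partition_on_card_1:
  assumes "U \<noteq> {}"
  shows "{P. partition_on U P \<and> card P = 1} = {{U}}"
  using assms by (auto simp: card_1_singleton_iff partition_on_def)

definition conn_egf :: "(nat, 'b) species_data \<Rightarrow> real fps" where
  "conn_egf B = Abs_fps (\<lambda>n. real (counting_seq B n) / fact n)"

context
  fixes A :: "(nat, 'a) species_data" and B :: "(nat, 'b) species_data"
    and \<phi> :: "nat set \<Rightarrow> 'a \<Rightarrow> nat set set \<times> nat set set \<times> (nat set \<Rightarrow> 'b)"
  assumes B: "species B" and B0: "structs B {} = {}"
    and iso: "natural_iso A (compose_species set_species B) \<phi>"
begin

lemma conn_egf_nth_0: "conn_egf B $ 0 = 0"
  using B0 by (simp add: conn_egf_def counting_seq_def)

lemma counting_seq_conv_exp: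
  "real (counting_seq A n) = fact n * (fps_exp 1 oo conn_egf B) $ n"
  using card_structs_num_components[OF B iso, of "{1..n}" "\<lambda>_. True"]
    sum_partition_on_exp[of "{1..n}" "\<lambda>n. real (counting_seq B n)" 1] B0
  by (simp add: counting_seq_def[of A] conn_egf_def) (simp add: counting_seq_def)

text \<open>With \<open>c = - 1\<close> the exponential formula gives a partition the sign
  \<open>(- 1) ^ card P\<close>, the opposite of its sign in \<open>signed_count\<close>.\<close>

lemma signed_count_conv_exp:
  "real_of_int (signed_count A \<phi> k) = - fact k * (fps_exp (- 1) oo conn_egf B) $ k"
proof -
  let ?w = "\<lambda>P. \<Prod>p\<in>P. real (counting_seq B (card p))"
  let ?S = "{P. partition_on {1..k} P}"
  have fin: "finite ?S" by (simp add: finitely_many_partition_on)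
  have count: "real (card {s \<in> structs A {1..k}. R (num_components (\<phi> {1..k} s))}) =
      (\<Sum>P\<in>?S. if R (card P) then ?w P else 0)" for R
    using fin by (subst card_structs_num_components[OF B iso]) (auto simp: sum.If_cases Int_def)
  have "real_of_int (signed_count A \<phi> k) =
      (\<Sum>P\<in>?S. (if odd (card P) then ?w P else 0) - (if even (card P) then ?w P else 0))"
    by (simp only: signed_count_def of_int_diff of_int_of_nat_eq count[of odd] count[of even] sum_subtractf)
  also have "\<dots> = (\<Sum>P\<in>?S. - (\<Prod>p\<in>P. - 1 * real (counting_seq B (card p))))"
    unfolding prod.distrib by (intro sum.cong) auto
  also have "\<dots> = - fact k * (fps_exp (- 1) oo conn_egf B) $ k"
    using sum_partition_on_exp[of "{1..k}" "\<lambda>n. real (counting_seq B n)" "- 1"] B0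
    by (simp add: sum_negf conn_egf_def counting_seq_def)
  finally show ?thesis .
qed

text \<open>One component forces the partition with the single block \<open>{1..n}\<close>, so the
  sum over partitions has one term.\<close>

lemma card_connected:
  assumes "n > 0"
  shows "card {s \<in> structs A {1..n}. is_connected (\<phi> {1..n} s)} = counting_seq B n"
proof -
  have "{1..n} \<noteq> {}" using assms by simp
  from partition_on_card_1[OF this] show ?thesis
    using card_structs_num_components[OF B iso, of "{1..n}" "\<lambda>m. m = 1"]
    by (simp add: is_connected_def)
qed

end

section \<open>Gargantuan series\<close>

text \<open>Condition (i), composed with \<open>n - i\<close>, gives one unit shift; unit shifts are
  chained by transitivity.\<close>

lemma gargantuan_shift_smallo:
  assumes "gargantuan a" "j < k"
  shows "(\<lambda>n. a (n - k)) \<in> o(\<lambda>n. a (n - j))"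
proof -
  have "(\<lambda>n. a (n - 1)) \<in> o(a)"
    using assms(1) by (intro smalloI_tendsto) (auto simp: gargantuan_def)
  from landau_o.small.compose[OF this filterlim_minus_const_nat_at_top]
  have step: "(\<lambda>n. a (n - Suc i)) \<in> o(\<lambda>n. a (n - i))" for i
    by (simp add: o_def)
  from assms(2) show ?thesis
    by (induction j k rule: less_Suc_induct) (auto intro: step landau_o.small_trans)
qed

lemma gargantuan_shift_bigo:
  assumes "gargantuan a" "j \<le> k"
  shows "(\<lambda>n. a (n - k)) \<in> O(\<lambda>n. a (n - j))"
  using gargantuan_shift_smallo[OF assms(1), of j k] assms(2)
  by (cases "j = k") (auto intro: landau_o.small_imp_big)

text \<open>\<open>w\<close> is a polynomial without terms below degree \<open>r\<close>, so for
  large \<open>n\<close> the coefficient is a sum of fixed length, dominated by its smallest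
  shift.\<close>

lemma gargantuan_finite_mult_bigo:
  fixes a :: "nat \<Rightarrow> real" and u w :: "real fps"
  assumes a: "gargantuan a"
    and w: "\<And>k. k < r \<Longrightarrow> w $ k = 0" "\<And>k. m \<le> k \<Longrightarrow> w $ k = 0"
    and u: "(\<lambda>n. u $ n) \<in> O(\<lambda>n. real n * a (n - s))"
  shows "(\<lambda>n. (w * u) $ n) \<in> O(\<lambda>n. real n * a (n - (r + s)))"
proof -
  have "(\<lambda>n. w $ k * u $ (n - k)) \<in> O(\<lambda>n. real n * a (n - (r + s)))" if "r \<le> k" for k
  proof -
    have "(\<lambda>n. u $ (n - k)) \<in> O(\<lambda>n. real (n - k) * a (n - k - s))"
      by (rule landau_o.big.compose[OF u filterlim_minus_const_nat_at_top])
    also have "(\<lambda>n. real (n - k) * a (n - k - s)) \<in> O(\<lambda>n. real n * a (n - (r + s)))"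
    proof (rule landau_o.big.mult)
      show "(\<lambda>n. real (n - k)) \<in> O(real)" by (intro bigoI[of _ 1]) auto
      show "(\<lambda>n. a (n - k - s)) \<in> O(\<lambda>n. a (n - (r + s)))"
        using gargantuan_shift_bigo[OF a, of "r + s" "k + s"] that by simp
    qed
    finally show ?thesis by (cases "w $ k = 0") auto
  qed
  then have "(\<lambda>n. \<Sum>k=r..<m. w $ k * u $ (n - k)) \<in> O(\<lambda>n. real n * a (n - (r + s)))"
    by (intro big_sum_in_bigo) auto
  moreover have "\<forall>\<^sub>F n in sequentially. (w * u) $ n = (\<Sum>k=r..<m. w $ k * u $ (n - k))"
    using eventually_ge_at_top[of m]
  proof eventually_elim
    case (elim n)
    then show "(w * u) $ n = (\<Sum>k=r..<m. w $ k * u $ (n - k))"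
      unfolding fps_mult_nth
      using w by (intro sum.mono_neutral_right) (auto simp: not_le)
  qed
  ultimately show ?thesis by (subst landau_o.big.in_cong) auto
qed

section \<open>Logarithm and inverse of a gargantuan series\<close>

lemma fps_XD_mult: "fps_XD (f * g) = f * fps_XD g + fps_XD f * (g :: 'a::comm_ring_1 fps)"
  by (simp add: fps_XD_def algebra_simps)

lemma fps_XD_nth: "fps_XD f $ n = of_nat n * (f :: 'a::comm_ring_1 fps) $ n"
  by (simp add: fps_XD_def)

lemma fps_cutoff_mult_nth_eq_0:
  "m + n \<le> k \<Longrightarrow> (fps_cutoff m f * fps_cutoff n (g :: 'a::comm_ring_1 fps)) $ k = 0"
  unfolding fps_mult_nth by (intro sum.neutral) auto

text \<open>\<open>A\<close>, \<open>B\<close>, \<open>C\<close> are the series F, H, C of the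
  overview: \<open>XD\<close> makes \<open>B\<close> a logarithm of \<open>A\<close> up to a
  constant, and \<open>AC\<close> makes \<open>C\<close> the inverse of \<open>A\<close>.\<close>

lemma gargantuan_log_expansion:
  fixes A B C :: "real fps"
  assumes a: "gargantuan (fps_nth A)"
    and XD: "fps_XD A = A * fps_XD B" and AC: "A * C = 1"
    and B: "\<And>n. \<bar>B $ n\<bar> \<le> A $ n"
  shows "(\<lambda>n. B $ n - (\<Sum>k<R. C $ k * A $ (n - k))) \<in> O(\<lambda>n. A $ (n - R))"
proof -
  have A0: "0 \<le> A $ n" for n using B[of n] by linarith
  define D where "D = fps_XD B"
  define c where "c = fps_cutoff R C"
  define p where "p = fps_cutoff R A"
  define d where "d = fps_cutoff R D"
  \<comment> \<open>\<open>M\<close> is what \<open>p * D + d * A\<close> misses of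
    \<open>A * D\<close>; the low-degree product \<open>p * d\<close> occurs in both summands and is
    corrected for.\<close>
  define M where "M = (A - p) * (D - d) - p * d"
  have Dn: "D $ n = real n * B $ n" for n by (simp add: D_def fps_XD_nth)
  have "fps_XD C = (A * C) * fps_XD C" by (simp add: AC)
  also have "\<dots> = C * (fps_XD (A * C) - fps_XD A * C)"
    by (simp add: fps_XD_mult algebra_simps)
  also have "fps_XD (A * C) = 0" by (simp add: AC fps_XD_def)
  also have "C * (0 - fps_XD A * C) = - (A * C) * (C * D)"
    by (simp add: XD D_def algebra_simps)
  finally have XDC: "fps_XD C = - (C * D)" by (simp add: AC)
  have decomp: "fps_XD (c * A) - D = (c * p - 1) * D + (c * d + fps_XD c) * A + c * M"
  proof -
    have "A * D = p * D + d * A + M" by (simp add: M_def algebra_simps)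
    then have "c * fps_XD A = c * (p * D + d * A + M)" by (simp add: XD D_def)
    then show ?thesis by (simp add: fps_XD_mult algebra_simps)
  qed
  \<comment> \<open>The form \<open>n - 0\<close> matches the shift \<open>s = 0\<close> in
    \<open>gargantuan_finite_mult_bigo\<close>.\<close>
  have D_O: "(\<lambda>n. D $ n) \<in> O(\<lambda>n. real n * A $ (n - 0))"
    using B by (intro bigoI[of _ 1]) (auto simp: Dn abs_mult A0 mult_left_mono)
  have A_O: "(\<lambda>n. A $ n) \<in> O(\<lambda>n. real n * A $ (n - 0))"
  proof (rule bigoI[of _ 1])
    show "\<forall>\<^sub>F n in sequentially. norm (A $ n) \<le> 1 * norm (real n * A $ (n - 0))"
      using eventually_ge_at_top[of 1]
    proof eventually_elim
      case (elim n)
      then show ?case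
        using A0[of n] mult_right_mono[of 1 "real n" "A $ n"] by (simp add: abs_mult)
    qed
  qed
  have M_O: "(\<lambda>n. M $ n) \<in> O(\<lambda>n. real n * A $ (n - R))"
  proof -
    have "\<forall>\<^sub>F n in sequentially.
      norm (M $ n) \<le> 1 * norm (real n * (\<Sum>k=R..n - R. \<bar>A $ k * A $ (n - k)\<bar>))"
      using eventually_ge_at_top[of "2 * R"]
    proof eventually_elim
      case (elim n)
      \<comment> \<open>From \<open>2 * R\<close> on, \<open>p * d\<close> has no coefficients, and
        the other product only pairs indices that are both at least \<open>R\<close>.\<close>
      have "M $ n = ((A - p) * (D - d)) $ n"
        using elim by (simp add: M_def p_def d_def fps_cutoff_mult_nth_eq_0)
      also have "\<dots> = (\<Sum>k=0..n. (A - p) $ k * (D - d) $ (n - k))"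
        by (simp add: fps_mult_nth)
      also have "\<dots> = (\<Sum>k=R..n - R. A $ k * D $ (n - k))"
        using elim by (intro sum.mono_neutral_cong_right) (auto simp: p_def d_def)
      finally have "\<bar>M $ n\<bar> \<le> (\<Sum>k=R..n - R. \<bar>A $ k * D $ (n - k)\<bar>)"
        using sum_abs by metis
      also have "\<dots> \<le> (\<Sum>k=R..n - R. real n * \<bar>A $ k * A $ (n - k)\<bar>)"
      proof (rule sum_mono)
        fix k
        have "\<bar>D $ (n - k)\<bar> \<le> real n * A $ (n - k)"
          using B[of "n - k"] A0[of "n - k"] by (auto simp: Dn abs_mult intro!: mult_mono)
        then have "A $ k * \<bar>D $ (n - k)\<bar> \<le> A $ k * (real n * A $ (n - k))"
          by (intro mult_left_mono A0)
        then show "\<bar>A $ k * D $ (n - k)\<bar> \<le> real n * \<bar>A $ k * A $ (n - k)\<bar>"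
          using A0 by (simp add: abs_mult mult_ac)
      qed
      finally show ?case
        by (simp add: sum_distrib_left[symmetric] abs_mult sum_nonneg)
    qed
    then have "(\<lambda>n. M $ n) \<in> O(\<lambda>n. real n * (\<Sum>k=R..n - R. \<bar>A $ k * A $ (n - k)\<bar>))"
      by (rule bigoI)
    also have "\<dots> \<subseteq> O(\<lambda>n. real n * A $ (n - R))"
      using a by (intro landau_o.big.subsetI landau_o.big.mult_left) (simp add: gargantuan_def)
    finally show ?thesis .
  qed
  have 1: "(\<lambda>n. ((c * p - 1) * D) $ n) \<in> O(\<lambda>n. real n * A $ (n - (R + 0)))"
  \<comment> \<open>The \<open>Suc\<close> accounts for \<open>R = 0\<close>, where
    \<open>c * p - 1\<close> is the constant \<open>- 1\<close>.\<close>
  proof (rule gargantuan_finite_mult_bigo[OF a _ _ D_O, where m = "Suc (2 * R)"])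
    show "(c * p - 1) $ k = 0" if "k < R" for k
      using that AC
      by (simp add: c_def p_def fps_cutoff_left_mult_nth fps_cutoff_right_mult_nth mult.commute)
    show "(c * p - 1) $ k = 0" if "Suc (2 * R) \<le> k" for k
      using that by (simp add: c_def p_def fps_cutoff_mult_nth_eq_0)
  qed
  have 2: "(\<lambda>n. ((c * d + fps_XD c) * A) $ n) \<in> O(\<lambda>n. real n * A $ (n - (R + 0)))"
  proof (rule gargantuan_finite_mult_bigo[OF a _ _ A_O, where m = "2 * R"])
    show "(c * d + fps_XD c) $ k = 0" if "k < R" for k
    proof -
      have "(c * d + fps_XD c) $ k = (C * D + fps_XD C) $ k"
        using that
        by (simp add: c_def d_def fps_XD_nth fps_cutoff_left_mult_nth fps_cutoff_right_mult_nth)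
      then show ?thesis by (simp add: XDC)
    qed
    show "(c * d + fps_XD c) $ k = 0" if "2 * R \<le> k" for k
      using that by (simp add: c_def d_def fps_XD_nth fps_cutoff_mult_nth_eq_0)
  qed
  have 3: "(\<lambda>n. (c * M) $ n) \<in> O(\<lambda>n. real n * A $ (n - (0 + R)))"
    by (rule gargantuan_finite_mult_bigo[OF a _ _ M_O, where m = R]) (auto simp: c_def)
  have "(\<lambda>n. (fps_XD (c * A) - D) $ n) \<in> O(\<lambda>n. real n * A $ (n - R))"
    unfolding decomp using sum_in_bigo(1)[OF sum_in_bigo(1)[OF 1[simplified] 2[simplified]] 3[simplified]]
    by simp
  \<comment> \<open>\<open>fps_XD\<close> multiplies coefficient \<open>n\<close> by
    \<open>n\<close>, a factor that then cancels against the one in the error bound.\<close>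
  moreover have "(fps_XD (c * A) - D) $ n = - (real n * (B $ n - (c * A) $ n))" for n
    by (simp add: fps_XD_nth Dn algebra_simps)
  ultimately have "(\<lambda>n. real n * (B $ n - (c * A) $ n)) \<in> O(\<lambda>n. real n * A $ (n - R))"
    by (simp only: landau_o.big.uminus_in_iff)
  moreover have "\<forall>\<^sub>F n in sequentially. real n \<noteq> 0"
    using eventually_gt_at_top[of 0] by eventually_elim simp
  ultimately have bound: "(\<lambda>n. B $ n - (c * A) $ n) \<in> O(\<lambda>n. A $ (n - R))"
    using landau_o.big.mult_cancel_left[OF bigtheta_refl] by blast
  have "\<forall>\<^sub>F n in sequentially. (c * A) $ n = (\<Sum>k<R. C $ k * A $ (n - k))"
    using eventually_ge_at_top[of R]
  proof eventually_elim
    case (elim n)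
    then show ?case unfolding fps_mult_nth
      by (intro sum.mono_neutral_cong_right) (auto simp: c_def)
  qed
  then have cong: "\<forall>\<^sub>F n in sequentially. B $ n - (c * A) $ n = B $ n - (\<Sum>k<R. C $ k * A $ (n - k))"
    by eventually_elim simp
  with bound show ?thesis using landau_o.big.in_cong[OF cong] by blast
qed

text \<open>Supplies the infinitude clause of \<open>asymp_expansion\<close>: a polynomial
  \<open>C\<close> would make \<open>A\<close> little-o of itself, hence eventually zero.\<close>

lemma gargantuan_inverse_infinite:
  fixes A C :: "real fps"
  assumes a: "gargantuan (fps_nth A)" and AC: "A * C = 1"
  shows "infinite {k. C $ k \<noteq> 0}"
proof
  assume "finite {k. C $ k \<noteq> 0}"
  then obtain m where m: "\<And>k. C $ k \<noteq> 0 \<Longrightarrow> k < m"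
    using finite_nat_iff_bounded[of "{k. C $ k \<noteq> 0}"] by auto
  have "(A * C) $ 0 = 1" by (simp add: AC)
  then have C0: "C $ 0 \<noteq> 0" by auto
  have "(\<lambda>n. \<Sum>k=1..<m. C $ k * A $ (n - k)) \<in> o(\<lambda>n. A $ n)"
  proof (rule big_sum_in_smallo)
    fix k assume "k \<in> {1..<m}"
    then have "(\<lambda>n. A $ (n - k)) \<in> o(\<lambda>n. A $ n)"
      using gargantuan_shift_smallo[OF a, of 0 k] by simp
    then show "(\<lambda>n. C $ k * A $ (n - k)) \<in> o(\<lambda>n. A $ n)"
      by (cases "C $ k = 0") auto
  qed
  moreover have "\<forall>\<^sub>F n in sequentially. (\<Sum>k=1..<m. C $ k * A $ (n - k)) = - C $ 0 * A $ n"
    using eventually_ge_at_top[of "Suc m"]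
  proof eventually_elim
    case (elim n)
    \<comment> \<open>Coefficient \<open>n > 0\<close> of the constant series 1, to be solved for
      the term \<open>k = 0\<close>.\<close>
    have "0 = (C * A) $ n" using elim by (simp add: mult.commute[of C A] AC)
    also have "\<dots> = (\<Sum>k<m. C $ k * A $ (n - k))"
      unfolding fps_mult_nth using elim m
      by (intro sum.mono_neutral_right) (auto simp: not_less)
    also have "{..<m} = insert 0 {1..<m}" using m[OF C0] by auto
    finally show ?case by simp
  qed
  ultimately have "(\<lambda>n. - C $ 0 * A $ n) \<in> o(\<lambda>n. A $ n)"
    by (subst (asm) landau_o.small.in_cong)
  then have "(\<lambda>n. A $ n) \<in> o(\<lambda>n. A $ n)" using C0 by simp
  then have "\<forall>\<^sub>F n in sequentially. A $ n = 0" by (simp add: landau_o.small_refl_iff)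
  moreover have "\<forall>\<^sub>F n in sequentially. A $ n \<noteq> 0" using a by (simp add: gargantuan_def)
  ultimately have "\<forall>\<^sub>F n::nat in sequentially. False" by eventually_elim simp
  then show False by simp
qed

section \<open>Asymptotic series with vanishing terms left out\<close>

text \<open>Omitting zero terms leaves partial sums unchanged, so the full sum below a nonzero index
  \<open>R\<close> is the sum of the enumerated terms before it. Remainders are thus needed only at
  such \<open>R\<close>.\<close>

lemma asymp_expansion_0I:
  assumes inf: "infinite (nonzero_terms 0 f)"
    and rem: "\<And>R. R \<in> nonzero_terms 0 f \<Longrightarrow> (\<lambda>n. x n - (\<Sum>k<R. f k n)) \<in> O(f R)"
    and small: "\<And>j k. j \<in> nonzero_terms 0 f \<Longrightarrow> j < k \<Longrightarrow> f k \<in> o(f j)"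
  shows "asymp_expansion 0 x f"
  unfolding asymp_expansion_def expansion_from_def
proof (intro conjI allI impI inf)
  let ?S = "nonzero_terms 0 f"
  let ?e = "enumerate ?S"
  have e: "?e i \<in> ?S" for i by (rule enumerate_in_set[OF inf])
  show "f (?e (Suc i)) \<in> o(f (?e i))" for i
    by (intro small e enumerate_step inf)
  fix r
  have "(\<Sum>k<?e (Suc r). f k n) = (\<Sum>i=0..r. f (?e i) n)" for n
  proof -
    have img: "?e ` {0..r} = {k \<in> ?S. k < ?e (Suc r)}"
    proof (intro equalityI subsetI)
      fix k assume "k \<in> {k \<in> ?S. k < ?e (Suc r)}"
      then obtain i where "k = ?e i" "k < ?e (Suc r)" using enumerate_Ex[OF inf, of k] by auto
      then show "k \<in> ?e ` {0..r}" using inf by auto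
    qed (use e inf in \<open>auto simp: less_Suc_eq_le\<close>)
    have "(\<Sum>k<?e (Suc r). f k n) = (\<Sum>k | k \<in> ?S \<and> k < ?e (Suc r). f k n)"
      by (intro sum.mono_neutral_right) (auto simp: nonzero_terms_def)
    also have "\<dots> = (\<Sum>i=0..r. f (?e i) n)"
      unfolding img[symmetric] using inf
      by (subst sum.reindex) (auto intro: inj_on_subset[OF inj_enumerate])
    finally show ?thesis .
  qed
  then show "(\<lambda>n. x n - (\<Sum>i=0..r. f (?e i) n)) \<in> O(f (?e (Suc r)))"
    using rem[OF e[of "Suc r"]] by simp
qed

section \<open>The expansion of the connectedness probability\<close>

theorem proposition3p6:
  fixes A :: "(nat, 'a) species_data"
    and B :: "(nat, 'b) species_data"
    and \<phi> :: "nat set \<Rightarrow> 'a \<Rightarrow> nat set set \<times> nat set set \<times> (nat set \<Rightarrow> 'b)"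
  assumes "species A"
    and "species B"
    and "structs B {} = {}"
    and "natural_iso A (compose_species set_species B) \<phi>"
    and "gargantuan_species A"
  shows "asymp_expansion 0
    (\<lambda>n. measure_pmf.prob (pmf_of_set (structs A {1..n})) {s. is_connected (\<phi> {1..n} s)})
    (\<lambda>k n. if k = 0 then 1
      else - (real_of_int (signed_count A \<phi> k) * real (n choose k) *
              (real (counting_seq A (n - k)) / real (counting_seq A n))))"
    (is "asymp_expansion 0 ?x ?f")
proof -
  interpret A: species A by fact
  define H where "H = conn_egf B"
  define F where "F = fps_exp 1 oo H"
  define C where "C = fps_exp (- 1) oo H"
  have H0: "H $ 0 = 0" unfolding H_def by (rule conn_egf_nth_0[OF assms(2-4)])
  have a: "real (counting_seq A n) = fact n * F $ n" for n
    unfolding F_def H_def by (rule counting_seq_conv_exp[OF assms(2-4)])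
  have d: "real_of_int (signed_count A \<phi> k) = - fact k * C $ k" for k
    unfolding C_def H_def by (rule signed_count_conv_exp[OF assms(2-4)])
  have garg: "gargantuan (fps_nth F)"
    using assms(5) by (simp add: gargantuan_species_def a)
  then have nz: "\<forall>\<^sub>F n in sequentially. F $ n \<noteq> 0" by (simp add: gargantuan_def)
  have FC: "F * C = 1"
    unfolding F_def C_def
    by (simp add: fps_compose_mult_distrib[OF H0, symmetric] fps_exp_add_mult[symmetric])
  have C0: "C $ 0 = 1" by (simp add: C_def)
  have XD: "fps_XD F = F * fps_XD H"
    unfolding F_def by (simp add: fps_XD_def fps_compose_deriv[OF H0] mult_ac)
  \<comment> \<open>Connected structures are among all structures, and \<open>H\<close> has no
    constant term.\<close>
  have "\<bar>H $ n\<bar> \<le> F $ n" for n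
  proof (cases "n = 0")
    case False
    have "counting_seq B n \<le> counting_seq A n"
      using False A.finite_structs
      by (auto simp: card_connected[OF assms(2-4), symmetric] counting_seq_def[of A] intro!: card_mono)
    then have "real (counting_seq B n) \<le> fact n * F $ n" using a[of n] by simp
    then show ?thesis by (simp add: H_def conn_egf_def field_simps)
  qed (use a[of 0] H0 in simp)
  note expansion = gargantuan_log_expansion[OF garg XD FC this]

  \<comment> \<open>The factorials in \<open>a\<close>, \<open>d\<close> and the binomial cancel,
    and the two minus signs too; \<open>C0\<close> accounts for the separate term
    \<open>k = 0\<close>.\<close>
  have f: "\<forall>\<^sub>F n in sequentially. ?f k n = C $ k * F $ (n - k) / F $ n" for k
    using nz eventually_ge_at_top[of k]
  proof eventually_elim
    case (elim n)
    then show ?case by (auto simp: C0 a d binomial_fact field_simps)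
  qed
  \<comment> \<open>Holds eventually: a vanishing \<open>F $ n\<close> means an empty set of
    structures, on which \<open>pmf_of_set\<close> is unspecified.\<close>
  have x: "\<forall>\<^sub>F n in sequentially. ?x n = H $ n / F $ n"
    using nz eventually_gt_at_top[of 0]
  proof eventually_elim
    case (elim n)
    then have "structs A {1..n} \<noteq> {}" using a[of n] by (auto simp: counting_seq_def)
    then have "?x n = real (card (structs A {1..n} \<inter> {s. is_connected (\<phi> {1..n} s)})) /
        real (counting_seq A n)"
      by (simp add: measure_pmf_of_set A.finite_structs counting_seq_def)
    also have "structs A {1..n} \<inter> {s. is_connected (\<phi> {1..n} s)} =
        {s \<in> structs A {1..n}. is_connected (\<phi> {1..n} s)}" by auto
    also have "card \<dots> = counting_seq B n" using elim by (intro card_connected[OF assms(2-4)])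
    finally show ?case by (simp add: a H_def conn_egf_def)
  qed
  \<comment> \<open>If \<open>C $ k = 0\<close>, the signed count is 0 and the term vanishes for
    every \<open>n\<close>; otherwise the term is nonzero for all large \<open>n\<close>.\<close>
  have nonzero: "?f k \<noteq> (\<lambda>_. 0) \<longleftrightarrow> C $ k \<noteq> 0" for k
  proof
    assume "?f k \<noteq> (\<lambda>_. 0)"
    then show "C $ k \<noteq> 0" using C0 by (auto simp: d fun_eq_iff split: if_splits)
  next
    assume Ck: "C $ k \<noteq> 0"
    have "\<forall>\<^sub>F n in sequentially. F $ (n - k) \<noteq> 0"
      using nz filterlim_minus_const_nat_at_top[of k] by (rule eventually_compose_filterlim)
    with f[of k] nz have "\<forall>\<^sub>F n in sequentially. ?f k n \<noteq> 0"
      by eventually_elim (use Ck in auto)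
    then obtain n where "?f k n \<noteq> 0" by (auto simp: eventually_sequentially)
    then show "?f k \<noteq> (\<lambda>_. 0)" by metis
  qed

  show ?thesis
  proof (rule asymp_expansion_0I)
    show "infinite (nonzero_terms 0 ?f)"
      using gargantuan_inverse_infinite[OF garg FC] by (simp only: nonzero_terms_def nonzero) simp
  next
    fix R assume "R \<in> nonzero_terms 0 ?f"
    then have CR: "C $ R \<noteq> 0" by (simp only: nonzero_terms_def nonzero) simp
    have "\<forall>\<^sub>F n in sequentially. \<forall>k\<in>{..<R}. ?f k n = C $ k * F $ (n - k) / F $ n"
      using f by (intro eventually_ball_finite) auto
    with x have cong: "\<forall>\<^sub>F n in sequentially. ?x n - (\<Sum>k<R. ?f k n) =
        (H $ n - (\<Sum>k<R. C $ k * F $ (n - k))) / F $ n"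
    proof eventually_elim
      case (elim n)
      then have "(\<Sum>k<R. ?f k n) = (\<Sum>k<R. C $ k * F $ (n - k) / F $ n)"
        by (intro sum.cong) auto
      with elim(1) show ?case by (simp only: diff_divide_distrib sum_divide_distrib)
    qed
    have "(\<lambda>n. (H $ n - (\<Sum>k<R. C $ k * F $ (n - k))) / F $ n) \<in> O(\<lambda>n. F $ (n - R) / F $ n)"
      by (rule landau_o.big.divide_right[OF nz expansion])
    \<comment> \<open>As term \<open>R\<close> is nonzero, the constant \<open>C $ R\<close> can be
      inserted into the bound.\<close>
    also have "(\<lambda>n. F $ (n - R) / F $ n) \<in> O(\<lambda>n. C $ R * F $ (n - R) / F $ n)"
      using CR by (intro bigoI[of _ "1 / \<bar>C $ R\<bar>"]) (simp add: abs_mult)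
    finally show "(\<lambda>n. ?x n - (\<Sum>k<R. ?f k n)) \<in> O(?f R)"
      using landau_o.big.in_cong[OF cong] landau_o.big.cong[OF f[of R]] by blast
  next
    fix j k :: nat assume "j \<in> nonzero_terms 0 ?f" and jk: "j < k"
    then have Cj: "C $ j \<noteq> 0" by (simp only: nonzero_terms_def nonzero) simp
    have "(\<lambda>n. F $ (n - k)) \<in> o(\<lambda>n. F $ (n - j))"
      by (rule gargantuan_shift_smallo[OF garg jk])
    then have "(\<lambda>n. C $ k * F $ (n - k)) \<in> o(\<lambda>n. C $ j * F $ (n - j))"
      using Cj by (cases "C $ k = 0") auto
    from landau_o.small.divide_right[OF nz this] show "?f k \<in> o(?f j)"
      using landau_o.small.in_cong[OF f[of k]] landau_o.small.cong[OF f[of j]] by blast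
  qed
qed

end
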